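(* Let $\mathbb{M}^d=(\mathbb{R}^d,\|\cdot\|)$ be a finite-dimensional real normed space. For every (nonempty) bounded set $K\subset\mathbb{M}^d$, $$\bigcap_{K^c}\mathrm{Ch}(K^c)\subseteq \mathrm{Ch}(K)\subseteq\bigcup_{K^c}\mathrm{Ch}(K^c),$$ where the intersection and the union are taken over all completions $K^c$ of $K$.
   Context: $B(x,\lambda)=\{y:\|y-x\|\le\lambda\}$ denotes the closed ball with center $x$ and radius $\lambda$. For a nonempty bounded set $K$, $\operatorname{diam}(K)=\sup\{\|x-y\|:x,y\in K\}$. The minimal enclosing radius (Chebyshev radius) $\lambda_K$ is the smallest number such that $K\subseteq B(x,\lambda_K)$ for some $x$; such a ball $B(x,\lambda_K)$ is a minimal enclosing ball of $K$. The Chebyshev set $\mathrm{Ch}(K)$ is the set of all centers $x$ of minimal enclosing balls of $K$. A bounded set is complete if it cannot be enlarged by additional points without increasing its diameter. A completion of $K$ is a complete set that contains $K$ and has the same diameter as $K$. *)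

theory Defs
  imports "HOL-Analysis.Analysis"
begin

text \<open>
  The diameter is the library's \<^const>\<open>diameter\<close>, which is meaningful only for bounded sets.

  The radius below is a genuine minimum, not an infimum: it is specified only for sets for
  which the minimum exists (in particular not for the empty set).
\<close>

definition chebyshev_radius :: "'a::real_normed_vector set \<Rightarrow> real" where
  "chebyshev_radius K = (LEAST r. \<exists>x. K \<subseteq> cball x r)"

definition chebyshev_set :: "'a::real_normed_vector set \<Rightarrow> 'a set" where
  "chebyshev_set K = {x. K \<subseteq> cball x (chebyshev_radius K)}"

text \<open>
  Completeness in the sense of diameters, unrelated to \<^const>\<open>complete\<close>. Only bounded
  enlargements \<open>L\<close> are considered because an unbounded one has infinite diameter, for which
  \<^const>\<open>diameter\<close> returns an unspecified real number.
\<close>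

definition diametrically_complete :: "'a::real_normed_vector set \<Rightarrow> bool" where
  "diametrically_complete K \<longleftrightarrow>
     bounded K \<and> (\<forall>L. K \<subset> L \<longrightarrow> bounded L \<longrightarrow> diameter K < diameter L)"

definition completions :: "'a::real_normed_vector set \<Rightarrow> 'a set set" where
  "completions K = {C. diametrically_complete C \<and> K \<subseteq> C \<and> diameter C = diameter K}"

end

theory Submission
  imports Defs
begin

text \<open>
  Let \<open>x\<close> be a Chebyshev center of \<open>K\<close>, with radius \<open>r\<close>, and let \<open>D\<close> be the diameter of \<open>K\<close>, so
  that \<open>D / 2 \<le> r \<le> D\<close>. Take \<open>C\<close> maximal among the sets of diameter \<open>D\<close> that lie between \<open>K\<close> and
  the ball \<open>B(x, r)\<close>. By maximality \<open>C\<close> contains the ball \<open>B(x, D - r)\<close>, since every point of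
  that ball has distance at most \<open>D\<close> from every point of \<open>B(x, r)\<close>. A point \<open>y\<close> outside \<open>B(x, r)\<close>
  has distance more than \<open>r + (D - r) = D\<close> from the point of \<open>B(x, D - r)\<close> opposite to \<open>y\<close>,
  so \<open>C\<close> is complete. Thus \<open>C\<close> is a completion of \<open>K\<close> with the same Chebyshev radius and with \<open>x\<close>
  among its Chebyshev centers. This gives the second inclusion, and also the first one: a Chebyshev
  center of \<open>C\<close> is a Chebyshev center of \<open>K\<close>, as the radii agree. Finite dimension is used only
  for the existence of a Chebyshev center.
\<close>

text \<open>A convergent sequence is bounded, so it lies together with its limit in a single
  ball.\<close>

lemma closed_if_compact_Int_cballs:
  fixes S :: "'a::real_normed_vector set"
  assumes "\<And>r. compact (cball 0 r \<inter> S)"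
  shows "closed S"
proof (unfold closed_sequential_limits, intro allI impI, elim conjE)
  fix f l
  assume f: "\<forall>n. f n \<in> S" and l: "f \<longlonglongrightarrow> l"
  obtain b where "\<And>n. norm (f n) \<le> b"
    using l convergentI convergent_imp_Bseq BseqE by metis
  then have "\<forall>n. f n \<in> cball 0 b \<inter> S"
    using f by simp
  moreover have "closed (cball 0 b \<inter> S)"
    using assms compact_imp_closed by blast
  ultimately have "l \<in> cball 0 b \<inter> S"
    using l closed_sequentially by blast
  then show "l \<in> S" by simp
qed

text \<open>The induction hypothesis for all radii makes \<open>span B\<close> closed, so a vector
  \<open>a\<close> outside it has positive distance from it. This bounds the coefficient of
  \<open>a\<close> on a ball.\<close>

lemma compact_cball_Int_span:
  fixes B :: "'a::real_normed_vector set"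
  assumes "finite B"
  shows "compact (cball 0 r \<inter> span B)"
  using assms
proof (induction B arbitrary: r rule: finite_induct)
  case empty
  have "cball 0 r \<inter> span {} \<subseteq> {0::'a}" by simp
  then show ?case
    by (meson finite.emptyI finite.insertI finite_imp_compact finite_subset)
next
  case (insert a B)
  show ?case
  proof (cases "a \<in> span B")
    case True
    then show ?thesis
      using insert.IH by (simp add: span_redundant)
  next
    case False
    have "closed (span B)"
      using insert.IH by (rule closed_if_compact_Int_cballs)
    then obtain d where "d > 0" and "ball a d \<subseteq> - span B"
      using False openE[of "- span B" a] by auto
    then have d: "d \<le> dist a s" if "s \<in> span B" for s
      using that by (meson ComplD mem_ball not_le subsetD)
    \<comment> \<open>\<open>T\<close> will bound the coefficient \<open>t\<close> of
      \<open>a\<close> in a vector of norm at most \<open>r\<close>; the remaining part in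
      \<open>span B\<close> then has norm at most \<open>r + T * norm a\<close>.\<close>
    define T where "T = r / d"
    define M where "M = (\<lambda>(s, t). s + t *\<^sub>R a) ` ((cball 0 (r + T * norm a) \<inter> span B) \<times> {-T..T})"
    have "compact M"
      unfolding M_def
      by (intro compact_continuous_image compact_Times insert.IH compact_Icc)
         (auto simp: case_prod_unfold intro!: continuous_intros)
    moreover have "M \<subseteq> span (insert a B)"
      unfolding M_def
      by (auto intro!: span_add span_scale intro: span_base
               dest: subsetD[OF span_mono[OF subset_insertI]])
    moreover have "cball 0 r \<inter> span (insert a B) \<subseteq> M"
    proof
      fix x assume x: "x \<in> cball 0 r \<inter> span (insert a B)"
      then obtain t where t: "x - t *\<^sub>R a \<in> span B"
        using span_breakdown_eq by blast
      \<comment> \<open>For nonzero \<open>t\<close>, the vector \<open>(1 / t) *\<^sub>R x\<close>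
        is the difference of \<open>a\<close> and a point of \<open>span B\<close>, so its norm is
        at least \<open>d\<close>.\<close>
      have "\<bar>t\<bar> * d \<le> norm x"
      proof (cases "t = 0")
        case False
        have "(- 1 / t) *\<^sub>R (x - t *\<^sub>R a) \<in> span B"
          using t span_scale by blast
        then have "d \<le> dist a ((- 1 / t) *\<^sub>R (x - t *\<^sub>R a))"
          by (rule d)
        also have "a - (- 1 / t) *\<^sub>R (x - t *\<^sub>R a) = (1 / t) *\<^sub>R x"
          using False by (simp add: algebra_simps)
        then have "dist a ((- 1 / t) *\<^sub>R (x - t *\<^sub>R a)) = norm x / \<bar>t\<bar>"
          by (simp add: dist_norm)
        finally show ?thesis
          using False by (simp add: field_simps)
      qed simp
      then have tT: "\<bar>t\<bar> \<le> T"
        using x \<open>d > 0\<close> by (simp add: T_def field_simps)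
      have "norm (x - t *\<^sub>R a) \<le> norm x + \<bar>t\<bar> * norm a"
        using norm_triangle_ineq4[of x "t *\<^sub>R a"] by simp
      also have "\<dots> \<le> r + T * norm a"
        using x tT by (intro add_mono mult_right_mono) auto
      finally show "x \<in> M"
        unfolding M_def using t tT by (intro image_eqI[of _ _ "(x - t *\<^sub>R a, t)"]) auto
    qed
    ultimately have "cball 0 r \<inter> span (insert a B) = M \<inter> cball 0 r" by blast
    then show ?thesis
      using compact_Int_closed[OF \<open>compact M\<close> closed_cball] by simp
  qed
qed

lemma compact_cball_finite_dim:
  fixes B :: "'a::real_normed_vector set"
  assumes "finite B" "span B = UNIV"
  shows "compact (cball (c::'a) r)"
proof -
  have "compact ((+) c ` cball 0 r)"
    using compact_cball_Int_span[OF assms(1), of r] assms(2)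
    by (intro compact_translation) simp
  then show ?thesis by simp
qed

lemma subset_cball_diameter:
  assumes "bounded K" "k \<in> K"
  shows "K \<subseteq> cball k (diameter K)"
  using assms diameter_bounded_bound by auto

lemma minimal_enclosing_ball_exists:
  fixes K :: "'a::real_normed_vector set"
  assumes compact: "\<And>(c::'a) r. compact (cball c r)"
    and "bounded K" "K \<noteq> {}"
  obtains x r where "K \<subseteq> cball x r" "\<And>y s. K \<subseteq> cball y s \<Longrightarrow> r \<le> s"
proof -
  obtain k where "k \<in> K" using \<open>K \<noteq> {}\<close> by blast
  define D where "D = diameter K"
  have KD: "K \<subseteq> cball k D"
    unfolding D_def using \<open>bounded K\<close> \<open>k \<in> K\<close> by (rule subset_cball_diameter)
  \<comment> \<open>Pairs of center and radius of enclosing balls. Radii above \<open>D\<close> can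
    be ignored because \<open>cball k D\<close> encloses \<open>K\<close>; for the others the center
    is within \<open>D\<close> of \<open>k\<close>. This makes the set of candidates
    compact.\<close>
  define F where "F = (cball k D \<times> {0..D}) \<inter> (\<Inter>y\<in>K. {p. dist (fst p) y \<le> snd p})"
  have F: "(x, r) \<in> F" if "K \<subseteq> cball x r" "r \<le> D" for x r
  proof -
    have "dist x k \<le> r" using that \<open>k \<in> K\<close> by auto
    then have "dist k x \<le> D" "0 \<le> r"
      using that(2) zero_le_dist[of x k] by (simp_all add: dist_commute del: zero_le_dist)
    then show ?thesis using that by (auto simp: F_def)
  qed
  have "compact F"
    unfolding F_def
    by (intro compact_Int_closed compact_Times compact compact_Icc closed_INT ballI
          closed_Collect_le continuous_intros)
  moreover have "F \<noteq> {}" using F[OF KD] by auto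
  ultimately have "\<exists>p\<in>F. \<forall>q\<in>F. snd p \<le> snd q"
    by (intro continuous_attains_inf continuous_intros)
  then obtain p where p: "p \<in> F" "\<And>q. q \<in> F \<Longrightarrow> snd p \<le> snd q"
    by blast
  show ?thesis
  proof
    show "K \<subseteq> cball (fst p) (snd p)"
      using p(1) by (auto simp: F_def)
    fix y s assume "K \<subseteq> cball y s"
    then show "snd p \<le> s"
      using p(1) p(2)[of "(y, s)"] F[of y s] by (cases "s \<le> D") (auto simp: F_def)
  qed
qed

lemma chebyshev_radius_eqI:
  assumes "K \<subseteq> cball x r" "\<And>y s. K \<subseteq> cball y s \<Longrightarrow> r \<le> s"
  shows "chebyshev_radius K = r"
  unfolding chebyshev_radius_def using assms by (intro Least_equality) blast+

text \<open>Zorn's lemma for inclusion: two points of the union of a chain lie in a common member.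
  The last conclusion is maximality tested by adding one point.\<close>

lemma maximal_in_ball_with_diameter:
  fixes K :: "'a::metric_space set"
  assumes "K \<subseteq> cball x r" "0 \<le> D" and "\<And>a b. a \<in> K \<Longrightarrow> b \<in> K \<Longrightarrow> dist a b \<le> D"
  obtains C where "K \<subseteq> C" "C \<subseteq> cball x r" "\<And>a b. a \<in> C \<Longrightarrow> b \<in> C \<Longrightarrow> dist a b \<le> D"
    "\<And>y. y \<in> cball x r \<Longrightarrow> (\<And>c. c \<in> C \<Longrightarrow> dist y c \<le> D) \<Longrightarrow> y \<in> C"
proof -
  define A where "A = {C. K \<subseteq> C \<and> C \<subseteq> cball x r \<and> (\<forall>a\<in>C. \<forall>b\<in>C. dist a b \<le> D)}"
  have "K \<in> A" using assms by (simp add: A_def)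
  have "\<exists>M\<in>A. \<forall>X\<in>A. M \<subseteq> X \<longrightarrow> X = M"
  proof (rule subset_Zorn_nonempty)
    show "A \<noteq> {}" using \<open>K \<in> A\<close> by blast
    fix \<C> assume "\<C> \<noteq> {}" and chain: "subset.chain A \<C>"
    then have "\<C> \<subseteq> A" and total: "\<And>X Y. X \<in> \<C> \<Longrightarrow> Y \<in> \<C> \<Longrightarrow> X \<subseteq> Y \<or> Y \<subseteq> X"
      by (auto simp: subset_chain_def)
    have "dist a b \<le> D" if "a \<in> X" "X \<in> \<C>" "b \<in> Y" "Y \<in> \<C>" for a b X Y
      using total[OF that(2,4)] that \<open>\<C> \<subseteq> A\<close> unfolding A_def by blast
    then have "\<forall>a\<in>\<Union>\<C>. \<forall>b\<in>\<Union>\<C>. dist a b \<le> D"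
      by (meson UnionE)
    moreover have "K \<subseteq> \<Union>\<C>" "\<Union>\<C> \<subseteq> cball x r"
      using \<open>\<C> \<noteq> {}\<close> \<open>\<C> \<subseteq> A\<close> unfolding A_def by fast+
    ultimately show "\<Union>\<C> \<in> A"
      by (simp add: A_def)
  qed
  then obtain C where C: "C \<in> A" and max: "\<And>X. X \<in> A \<Longrightarrow> C \<subseteq> X \<Longrightarrow> X = C"
    by blast
  show ?thesis
  proof (rule that)
    show "K \<subseteq> C" "C \<subseteq> cball x r"
      using C by (simp_all add: A_def)
    show "dist a b \<le> D" if "a \<in> C" "b \<in> C" for a b
      using C that by (simp add: A_def)
    fix y assume "y \<in> cball x r" "\<And>c. c \<in> C \<Longrightarrow> dist y c \<le> D"
    then have "insert y C \<in> A"
      using C \<open>0 \<le> D\<close> by (auto simp: A_def dist_commute)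
    then show "y \<in> C" using max by blast
  qed
qed

lemma completion_with_chebyshev_center:
  fixes K :: "'a::real_normed_vector set"
  assumes "bounded K" "K \<noteq> {}" and ball: "K \<subseteq> cball x r"
    and least: "\<And>y s. K \<subseteq> cball y s \<Longrightarrow> r \<le> s"
  obtains C where "C \<in> completions K" "chebyshev_radius C = r" "C \<subseteq> cball x r"
proof -
  define D where "D = diameter K"
  obtain k where "k \<in> K" using \<open>K \<noteq> {}\<close> by blast
  have "D \<ge> 0" unfolding D_def using \<open>bounded K\<close> by (rule diameter_ge_0)
  have "r \<le> D"
    using least subset_cball_diameter[OF \<open>bounded K\<close> \<open>k \<in> K\<close>] unfolding D_def by blast
  have "r \<ge> 0" using ball \<open>k \<in> K\<close> order_trans[OF zero_le_dist, of x k r] by auto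
  \<comment> \<open>Equivalently D - r \<le> r, which puts \<open>cball x (D - r)\<close> inside
    \<open>cball x r\<close>, where \<open>max\<close> applies.\<close>
  have "D \<le> 2 * r"
  proof -
    have "diameter K \<le> diameter (cball x r)"
      by (intro diameter_subset ball bounded_cball)
    also have "\<dots> \<le> 2 * r"
    proof (rule diameter_le)
      fix a b assume "a \<in> cball x r" "b \<in> cball x r"
      then show "norm (a - b) \<le> 2 * r"
        using dist_triangle3[of a b x] by (simp add: dist_norm)
    qed (use \<open>r \<ge> 0\<close> in simp)
    finally show ?thesis by (simp add: D_def)
  qed
  obtain C where C: "K \<subseteq> C" "C \<subseteq> cball x r" "\<And>a b. a \<in> C \<Longrightarrow> b \<in> C \<Longrightarrow> dist a b \<le> D"
    and max: "\<And>y. y \<in> cball x r \<Longrightarrow> (\<And>c. c \<in> C \<Longrightarrow> dist y c \<le> D) \<Longrightarrow> y \<in> C"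
    using maximal_in_ball_with_diameter[OF ball \<open>D \<ge> 0\<close>]
      diameter_bounded_bound[OF \<open>bounded K\<close>] unfolding D_def by blast
  have "bounded C" using C(2) bounded_cball bounded_subset by blast
  have diam: "diameter C = D"
  proof (rule antisym)
    show "diameter C \<le> D"
      using C(3) \<open>D \<ge> 0\<close> by (intro diameter_le) (auto simp: dist_norm)
    show "D \<le> diameter C"
      unfolding D_def using C(1) \<open>bounded C\<close> by (rule diameter_subset)
  qed
  have inner: "cball x (D - r) \<subseteq> C"
  proof
    fix q assume q: "q \<in> cball x (D - r)"
    show "q \<in> C"
    proof (rule max)
      show "q \<in> cball x r" using q \<open>D \<le> 2 * r\<close> by simp
      fix c assume "c \<in> C"
      then have "dist x c \<le> r" using C(2) by auto
      then show "dist q c \<le> D"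
        using q dist_triangle3[of q c x] by simp
    qed
  qed
  \<comment> \<open>Completeness concerns all points of the space, whereas \<open>max\<close> covers
    only those of \<open>cball x r\<close>.\<close>
  have complete: "y \<in> C" if y: "\<And>c. c \<in> C \<Longrightarrow> dist y c \<le> D" for y
  proof (rule max)
    show "y \<in> cball x r"
    proof (rule ccontr)
      assume "y \<notin> cball x r"
      then have far: "norm (y - x) > r" by (simp add: dist_norm norm_minus_commute)
      define n where "n = norm (y - x)"
      \<comment> \<open>The point at distance \<open>D - r\<close> beyond \<open>x\<close> on the
        ray from \<open>y\<close> through \<open>x\<close>, so that the distances add up to
        \<open>n + (D - r)\<close>.\<close>
      define q where "q = x - ((D - r) / n) *\<^sub>R (y - x)"
      have "n > 0" using far \<open>r \<ge> 0\<close> unfolding n_def by linarith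
      then have "dist x q = D - r"
        using \<open>r \<le> D\<close> by (simp add: q_def dist_norm n_def)
      then have "dist y q \<le> D" using inner by (intro y) auto
      moreover have "y - q = (1 + (D - r) / n) *\<^sub>R (y - x)"
        by (simp add: q_def algebra_simps)
      then have "dist y q = (1 + (D - r) / n) * n"
        using \<open>n > 0\<close> \<open>r \<le> D\<close> by (simp add: dist_norm n_def)
      then have "dist y q = n + (D - r)"
        using \<open>n > 0\<close> by (simp add: distrib_right)
      ultimately show False using far by (simp add: n_def)
    qed
  qed (rule y)
  have "diametrically_complete C"
    unfolding diametrically_complete_def
  proof (intro conjI allI impI)
    fix L assume "C \<subset> L" "bounded L"
    then obtain y where "y \<in> L" "y \<notin> C" by blast
    then obtain c where "c \<in> C" "dist y c > D" using complete by force
    moreover have "dist y c \<le> diameter L"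
      using \<open>y \<in> L\<close> \<open>c \<in> C\<close> \<open>C \<subset> L\<close> \<open>bounded L\<close> diameter_bounded_bound by blast
    ultimately show "diameter C < diameter L" using diam by linarith
  qed fact
  then have "C \<in> completions K"
    using C(1) diam by (simp add: completions_def D_def)
  \<comment> \<open>A ball enclosing \<open>C\<close> also encloses \<open>K\<close>, so its radius
    is at least \<open>r\<close>.\<close>
  moreover have "chebyshev_radius C = r"
    using C(2) by (rule chebyshev_radius_eqI) (use C(1) least in blast)
  ultimately show ?thesis using C(2) that by blast
qed

theorem theorem1:
  fixes K :: "'a::real_normed_vector set"
  assumes finite_dim: "\<exists>B :: 'a set. finite B \<and> span B = UNIV"
    and "bounded K" and "K \<noteq> {}"
  shows "(\<Inter>C\<in>completions K. chebyshev_set C) \<subseteq> chebyshev_set K \<and>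
         chebyshev_set K \<subseteq> (\<Union>C\<in>completions K. chebyshev_set C)"
proof -
  obtain x r where ball: "K \<subseteq> cball x r" and least: "\<And>y s. K \<subseteq> cball y s \<Longrightarrow> r \<le> s"
    using minimal_enclosing_ball_exists[OF _ \<open>bounded K\<close> \<open>K \<noteq> {}\<close>]
      finite_dim compact_cball_finite_dim by metis
  have radius: "chebyshev_radius K = r"
    using ball least by (rule chebyshev_radius_eqI)
  have completion: "\<exists>C\<in>completions K. chebyshev_radius C = r \<and> C \<subseteq> cball z r"
    if "K \<subseteq> cball z r" for z
    by (rule completion_with_chebyshev_center[OF \<open>bounded K\<close> \<open>K \<noteq> {}\<close> that])
       (blast intro: least)+
  show ?thesis
  proof
    \<comment> \<open>One completion of radius \<open>r\<close> suffices, and one must exist: the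
      intersection over an empty family would be the whole space.\<close>
    obtain C where "C \<in> completions K" "chebyshev_radius C = r"
      using completion[OF ball] by blast
    then have "chebyshev_set C \<subseteq> chebyshev_set K"
      using radius by (auto simp: chebyshev_set_def completions_def)
    then show "(\<Inter>C\<in>completions K. chebyshev_set C) \<subseteq> chebyshev_set K"
      using \<open>C \<in> completions K\<close> by blast
    show "chebyshev_set K \<subseteq> (\<Union>C\<in>completions K. chebyshev_set C)"
    proof
      fix z assume "z \<in> chebyshev_set K"
      then obtain C where "C \<in> completions K" "chebyshev_radius C = r" "C \<subseteq> cball z r"
        using completion[of z] radius unfolding chebyshev_set_def by blast
      then show "z \<in> (\<Union>C\<in>completions K. chebyshev_set C)"
        by (auto simp: chebyshev_set_def)
    qed
  qed
qed

end
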